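(* Let $(X,\|\cdot\|_X)$ and $(W,\|\cdot\|_W)$ be Banach spaces such that $X\hookrightarrow W$ continuously. Let $J\in C^1(X,\mathbb{R})$ be such that $J(0)=0$ and $J$ satisfies the weak Cerami--Palais--Smale condition $(wCPS)_\beta$ at each level $\beta\in\mathbb{R}_+=(0,+\infty)$. Moreover, assume that there exist a continuous map $\ell:X\to\mathbb{R}$, some constants $r_0,\varrho_0>0$, and $e\in X$ such that (i) $\ell(0)=0$ and $\ell(u)\ge\|u\|_W$ for all $u\in X$; (ii) if $u\in X$ and $\ell(u)=r_0$, then $J(u)\ge\varrho_0$; (iii) $\|e\|_W>r_0$ and $J(e)<\varrho_0$. Then $J$ has a Mountain Pass critical point $u_0\in X$ such that $J(u_0)\ge\varrho_0$; that is, there is $u_0\in X$ with $dJ(u_0)=0$ and $$J(u_0)=\inf_{\gamma\in\Gamma}\ \sup_{\sigma\in[0,1]}J(\gamma(\sigma))\ \ge\ \varrho_0,\qquad \Gamma=\{\gamma\in C([0,1],X):\ \gamma(0)=0,\ \gamma(1)=e\}.$$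
   Context: $X\hookrightarrow W$ continuously means $X\subset W$ and there is $\sigma_0>0$ with $\|u\|_W\le\sigma_0\|u\|_X$ for all $u\in X$. Topological notions in $X$ refer to $\|\cdot\|_X$; $X'$ is the dual of $X$. For $\beta\in\mathbb{R}$, a $(CPS)_\beta$-sequence is a sequence $(u_n)_n\subset X$ with $J(u_n)\to\beta$ and $\|dJ(u_n)\|_{X'}(1+\|u_n\|_X)\to0$. $J$ satisfies the weak Cerami--Palais--Smale condition at level $\beta$, $(wCPS)_\beta$, if for every $(CPS)_\beta$-sequence $(u_n)_n$ there is $u\in X$ such that, up to subsequences, $\|u_n-u\|_W\to0$, and $J(u)=\beta$, $dJ(u)=0$. *)

theory Defs
  imports "HOL-Analysis.Analysis"
begin

text \<open>The inclusion of \<open>X\<close> in \<open>W\<close> is an injective linear map \<open>i\<close>; for \<open>u\<close> in \<open>X\<close>, the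
  \<open>W\<close>-norm of \<open>u\<close> is \<open>norm (i u)\<close>.\<close>

definition continuous_embedding ::
    "('x::real_normed_vector \<Rightarrow> 'w::real_normed_vector) \<Rightarrow> bool" where
  "continuous_embedding i \<longleftrightarrow>
     linear i \<and> inj i \<and> (\<exists>\<sigma>\<^sub>0>0. \<forall>u. norm (i u) \<le> \<sigma>\<^sub>0 * norm u)"

text \<open>The Frechet differential as an element of the dual space, so that its norm is the dual norm.
  It is meaningful only where \<open>J\<close> is differentiable.\<close>

definition differential ::
    "('x::real_normed_vector \<Rightarrow> real) \<Rightarrow> 'x \<Rightarrow> ('x \<Rightarrow>\<^sub>L real)" where
  "differential J u = Blinfun (frechet_derivative J (at u))"

lemma has_derivative_differential:
  assumes "J differentiable (at u)"
  shows "(J has_derivative blinfun_apply (differential J u)) (at u)"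
  using assms
  by (metis differential_def bounded_linear_Blinfun_apply frechet_derivative_works
      has_derivative_bounded_linear)

lemma differential_unique:
  assumes "(J has_derivative blinfun_apply D) (at u)"
  shows "differential J u = D"
  by (simp add: differential_def frechet_derivative_at[OF assms, symmetric] blinfun_apply_inverse)

definition C1_functional :: "('x::real_normed_vector \<Rightarrow> real) \<Rightarrow> bool" where
  "C1_functional J \<longleftrightarrow>
     (\<forall>u. J differentiable (at u)) \<and> continuous_on UNIV (differential J)"

definition CPS_sequence ::
    "('x::real_normed_vector \<Rightarrow> real) \<Rightarrow> real \<Rightarrow> (nat \<Rightarrow> 'x) \<Rightarrow> bool" where
  "CPS_sequence J \<beta> u \<longleftrightarrow>
     (\<lambda>n. J (u n)) \<longlonglongrightarrow> \<beta> \<and>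
     (\<lambda>n. norm (differential J (u n)) * (1 + norm (u n))) \<longlonglongrightarrow> 0"

text \<open>The subsequence converges in the norm of \<open>W\<close> only, but its limit lies in \<open>X\<close>.\<close>

definition wCPS ::
    "('x::real_normed_vector \<Rightarrow> 'w::real_normed_vector) \<Rightarrow> ('x \<Rightarrow> real) \<Rightarrow> real \<Rightarrow> bool" where
  "wCPS i J \<beta> \<longleftrightarrow>
     (\<forall>u. CPS_sequence J \<beta> u \<longrightarrow>
        (\<exists>v. (\<exists>r::nat \<Rightarrow> nat. strict_mono r \<and> (\<lambda>n. norm (i (u (r n) - v))) \<longlonglongrightarrow> 0) \<and>
             J v = \<beta> \<and> differential J v = 0))"

definition mp_paths :: "'x::real_normed_vector \<Rightarrow> (real \<Rightarrow> 'x) set" where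
  "mp_paths e = {\<gamma>. continuous_on {0..1} \<gamma> \<and> \<gamma> 0 = 0 \<and> \<gamma> 1 = e}"

text \<open>For continuous \<open>J\<close> each supremum is over a nonempty compact set and the infimum is over a
  nonempty set bounded below by \<open>J 0\<close>, so the real-valued \<open>INF\<close> and \<open>SUP\<close> are the usual ones.\<close>

definition mp_level :: "('x::real_normed_vector \<Rightarrow> real) \<Rightarrow> 'x \<Rightarrow> real" where
  "mp_level J e = (INF \<gamma>\<in>mp_paths e. SUP \<sigma>\<in>{0..1}. J (\<gamma> \<sigma>))"

end

theory Submission
  imports Defs
begin

text \<open>
  A path from \<open>0\<close> to \<open>e\<close> starts where \<open>l = 0\<close> and ends where \<open>l > r\<^sub>0\<close>, so it crosses the
  level set \<open>l = r\<^sub>0\<close>, on which \<open>J \<ge> \<rho>\<^sub>0\<close>. Hence the minimax level \<open>c\<close> is at least \<open>\<rho>\<^sub>0\<close> and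
  lies strictly above the values of \<open>J\<close> at both endpoints (\<open>mp_level_ge_barrier\<close>). It remains to
  find a Cerami sequence at level \<open>c\<close> (\<open>mountain_pass_CPS_sequence\<close>); the compactness
  condition turns it into a critical point with value \<open>c\<close>.

  If there were no such sequence, then \<open>\<parallel>dJ u\<parallel> (1 + \<parallel>u\<parallel>) \<ge> \<epsilon>\<close> would hold for all \<open>u\<close> with
  \<open>\<bar>J u - c\<bar> \<le> \<epsilon>\<close>. Instead of integrating a pseudo-gradient flow, the proof deforms single paths
  and iterates as in Ekeland's variational principle. A path whose maximum lies in
  \<open>[c, c + \<epsilon>]\<close> is compact, so a partition of unity on \<open>[0,1]\<close> patches finitely many directions
  of steep descent into a continuous field along it. Moving each point \<open>x\<close> of the path along this
  field by at most \<open>h (1 + \<parallel>x\<parallel>)\<close> lowers the maximum by at least \<open>\<epsilon> h / 4\<close>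
  (\<open>path_lowering\<close>), but the admissible \<open>h > 0\<close> depends on the path, as \<open>dJ\<close> is only continuous.

  This is overcome by always making a move that is almost as long as possible among those that
  lower the maximum proportionally to their length \<open>s\<close>. The maxima are bounded below, so
  the lengths are summable. Each move multiplies \<open>1 + \<parallel>x\<parallel>\<close> by at most \<open>1 + s\<close>, so the paths stay
  in a bounded set and converge uniformly. The limit path admits no further move
  (\<open>path_without_lowering_step\<close>), for such a move would have been available, and preferable, late in
  the iteration. This contradicts \<open>path_lowering\<close>. The weight \<open>1 + \<parallel>x\<parallel>\<close> in the length of a
  move is what yields the Cerami condition rather than the weaker Palais--Smale one.
\<close>

section \<open>Continuous selections from locally constant ones\<close>

lemma finite_partition_of_unity:
  fixes K :: "'a::metric_space set"
  assumes "finite \<C>" "K \<subseteq> \<Union>\<C>" "\<And>U. U \<in> \<C> \<Longrightarrow> open U"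
  obtains F :: "'a set \<Rightarrow> 'a \<Rightarrow> real"
  where "\<And>U. U \<in> \<C> \<Longrightarrow> continuous_on K (F U)"
    and "\<And>U x. U \<in> \<C> \<Longrightarrow> x \<in> K \<Longrightarrow> 0 \<le> F U x"
    and "\<And>U x. U \<in> \<C> \<Longrightarrow> x \<in> K \<Longrightarrow> x \<notin> U \<Longrightarrow> F U x = 0"
    and "\<And>x. x \<in> K \<Longrightarrow> (\<Sum>U\<in>\<C>. F U x) = 1"
proof -
  have fin: "\<exists>V. open V \<and> x \<in> V \<and> finite {U \<in> \<C>. U \<inter> V \<noteq> {}}" for x
    using assms(1) by (intro exI[of _ UNIV]) auto
  obtain F :: "'a set \<Rightarrow> 'a \<Rightarrow> real" where F:
    "\<And>U. U \<in> \<C> \<Longrightarrow> continuous_on K (F U) \<and> (\<forall>x\<in>K. 0 \<le> F U x)"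
    "\<And>x U. \<lbrakk>U \<in> \<C>; x \<in> K; x \<notin> U\<rbrakk> \<Longrightarrow> F U x = 0"
    "\<And>x. x \<in> K \<Longrightarrow> supp_sum (\<lambda>W. F W x) \<C> = 1"
    by (rule subordinate_partition_of_unity[OF assms(2,3) fin]) (assumption | rule that)+
  have "(\<Sum>U\<in>\<C>. F U x) = 1" if "x \<in> K" for x
  proof -
    have "(\<Sum>U\<in>\<C>. F U x) = supp_sum (\<lambda>W. F W x) \<C>"
      unfolding supp_sum_def support_on_def
      by (rule sum.mono_neutral_right) (use assms(1) in auto)
    then show ?thesis using F(3)[OF that] by simp
  qed
  with F show ?thesis by (intro that[of F]) auto
qed

text \<open>Values of locally constant selections can be averaged with a partition of unity, because the
  sets \<open>\<Phi> x\<close> are convex.\<close>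

lemma continuous_selection_compact:
  fixes K :: "'a::metric_space set" and \<Phi> :: "'a \<Rightarrow> 'b::real_normed_vector set"
  assumes "compact K"
    and convex: "\<And>x. x \<in> K \<Longrightarrow> convex (\<Phi> x)"
    and local: "\<And>x. x \<in> K \<Longrightarrow> \<exists>U w. open U \<and> x \<in> U \<and> (\<forall>y\<in>K \<inter> U. w \<in> \<Phi> y)"
  obtains f where "continuous_on K f" "\<And>x. x \<in> K \<Longrightarrow> f x \<in> \<Phi> x"
proof -
  define \<U> where "\<U> = {U. open U \<and> (\<exists>w. \<forall>y\<in>K \<inter> U. w \<in> \<Phi> y)}"
  have "\<And>U. U \<in> \<U> \<Longrightarrow> open U" "K \<subseteq> \<Union>\<U>"
    using local unfolding \<U>_def by blast+
  then obtain \<C> where \<C>: "\<C> \<subseteq> \<U>" "finite \<C>" "K \<subseteq> \<Union>\<C>"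
    using compactE[OF \<open>compact K\<close>] by metis
  then have "\<forall>U\<in>\<C>. \<exists>w. \<forall>y\<in>K \<inter> U. w \<in> \<Phi> y"
    unfolding \<U>_def by blast
  then obtain w where w: "\<And>U y. U \<in> \<C> \<Longrightarrow> y \<in> K \<Longrightarrow> y \<in> U \<Longrightarrow> w U \<in> \<Phi> y"
    by (metis IntI)
  have open_\<C>: "open U" if "U \<in> \<C>" for U
    using \<C>(1) that unfolding \<U>_def by blast
  obtain F :: "'a set \<Rightarrow> 'a \<Rightarrow> real" where F:
    "\<And>U. U \<in> \<C> \<Longrightarrow> continuous_on K (F U)"
    "\<And>U x. U \<in> \<C> \<Longrightarrow> x \<in> K \<Longrightarrow> 0 \<le> F U x"
    "\<And>U x. U \<in> \<C> \<Longrightarrow> x \<in> K \<Longrightarrow> x \<notin> U \<Longrightarrow> F U x = 0"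
    "\<And>x. x \<in> K \<Longrightarrow> (\<Sum>U\<in>\<C>. F U x) = 1"
    by (rule finite_partition_of_unity[OF \<C>(2,3) open_\<C>]) (assumption | rule that)+
  define f where "f = (\<lambda>x. \<Sum>U\<in>\<C>. F U x *\<^sub>R w U)"
  have "continuous_on K f"
    unfolding f_def by (intro continuous_intros F)
  moreover have "f x \<in> \<Phi> x" if "x \<in> K" for x
  proof -
    define \<C>' where "\<C>' = {U \<in> \<C>. x \<in> U}"
    have eq: "(\<Sum>U\<in>\<C>'. F U x *\<^sub>R w U) = f x" "(\<Sum>U\<in>\<C>'. F U x) = 1"
      unfolding f_def F(4)[OF that, symmetric]
      by (rule sum.mono_neutral_left; use \<C>(2) F(3) that in \<open>auto simp: \<C>'_def\<close>)+
    have "(\<Sum>U\<in>\<C>'. F U x *\<^sub>R w U) \<in> \<Phi> x"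
      by (rule convex_sum[OF _ convex[OF that]])
        (use \<C>(2) F(2) w that eq in \<open>auto simp: \<C>'_def\<close>)
    then show ?thesis by (simp add: eq)
  qed
  ultimately show ?thesis using that by blast
qed

section \<open>Lowering a steep path\<close>

text \<open>For \<open>b = d'\<close> and \<open>a = 1 + \<parallel>u\<parallel>\<close> this turns the negated Cerami condition at \<open>u\<close> into a
  vector. The strict bound on its norm is what survives passing to nearby points.\<close>

lemma steep_direction:
  fixes D :: "'x::real_normed_vector \<Rightarrow>\<^sub>L real"
  assumes "b < norm D * a" "0 < a" "0 \<le> b"
  obtains w where "norm w < a" "b < D w"
proof -
  have "b / a < norm D" using assms by (simp add: field_simps)
  then have "\<not> (\<forall>x. norm (D x) \<le> b / a * norm x)"
    using norm_blinfun_bound[of "b / a" D] assms by fastforce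
  then obtain x where x: "b / a * norm x < \<bar>D x\<bar>" by (metis not_le real_norm_def)
  define y where "y = sgn (D x) *\<^sub>R x"
  have "0 \<le> b / a * norm x" using assms by simp
  with x have "D x \<noteq> 0" by auto
  then have y: "b / a * norm y < D y"
    using x by (auto simp: y_def sgn_if blinfun.bilinear_simps)
  then have "y \<noteq> 0" by auto
  moreover have "0 < D y" using y assms
    by (smt (verit) divide_nonneg_nonneg mult_nonneg_nonneg norm_ge_zero)
  ultimately have "b / D y < a / norm y"
    using y assms by (simp add: field_simps)
  then obtain t where t: "b / D y < t" "t < a / norm y" using dense by blast
  moreover have "0 \<le> t" using t(1) \<open>0 < D y\<close> assms by (smt (verit) divide_nonneg_pos)
  ultimately show ?thesis
    using \<open>y \<noteq> 0\<close> \<open>0 < D y\<close>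
    by (intro that[of "t *\<^sub>R y"]) (simp_all add: field_simps blinfun.bilinear_simps)
qed

lemma C1_functional_continuous:
  assumes "C1_functional J"
  shows "continuous_on S J"
  using assms unfolding C1_functional_def
  by (meson continuous_at_imp_continuous_on differentiable_imp_continuous_within)

text \<open>A direction of steep descent at \<open>\<gamma> t\<close> is still one at \<open>\<gamma> s\<close> for \<open>s\<close> near \<open>t\<close>, since \<open>dJ\<close> is
  continuous, and the constraints on a direction are convex. Where \<open>J (\<gamma> t) < m\<close> the zero vector is
  admissible; as this includes the endpoints, the field can be required to vanish there, so that
  deformed paths keep their endpoints. The loss from \<open>d\<close> to \<open>d'\<close> arises because the dual norm need
  not be attained.\<close>

lemma descent_field_along_path:
  fixes \<gamma> :: "real \<Rightarrow> 'x::real_normed_vector"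
  assumes C1: "C1_functional J"
    and \<gamma>: "continuous_on {0..1} \<gamma>"
    and ends: "J (\<gamma> 0) < m" "J (\<gamma> 1) < m"
    and d: "0 \<le> d'" "d' < d"
    and steep: "\<And>t. t \<in> {0..1} \<Longrightarrow> m \<le> J (\<gamma> t) \<Longrightarrow>
        d \<le> norm (differential J (\<gamma> t)) * (1 + norm (\<gamma> t))"
  obtains w where "continuous_on {0..1} w" "w 0 = 0" "w 1 = 0"
    and "\<And>t. t \<in> {0..1} \<Longrightarrow> norm (w t) \<le> 1 + norm (\<gamma> t)"
    and "\<And>t. t \<in> {0..1} \<Longrightarrow> m \<le> J (\<gamma> t) \<Longrightarrow> d' < differential J (\<gamma> t) (w t)"
proof -
  define I where "I = {0..1::real}"
  define \<Phi> where "\<Phi> t = {w. norm w \<le> 1 + norm (\<gamma> t) \<and> (t \<in> {0,1} \<longrightarrow> w = 0) \<and>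
    (m \<le> J (\<gamma> t) \<longrightarrow> d' < differential J (\<gamma> t) w)}" for t
  have contJ: "continuous_on I (\<lambda>t. J (\<gamma> t))"
    unfolding I_def by (rule continuous_on_compose2[OF C1_functional_continuous[OF C1, of UNIV] \<gamma>]) auto
  have contD: "continuous_on I (\<lambda>t. differential J (\<gamma> t))"
    using C1 \<gamma> unfolding C1_functional_def I_def
    by (auto intro: continuous_on_compose2)
  have relopen: "\<exists>U. open U \<and> t \<in> U \<and> (\<forall>s\<in>I \<inter> U. P s)"
    if "t \<in> I" "P t" "openin (top_of_set I) {s \<in> I. P s}" for t and P :: "real \<Rightarrow> bool"
    using that unfolding openin_open by blast
  have "convex (\<Phi> t)" for t
  proof -
    have "\<Phi> t = cball 0 (1 + norm (\<gamma> t)) \<inter> (if t \<in> {0,1} then {0} else UNIV) \<inter>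
      (if m \<le> J (\<gamma> t) then blinfun_apply (differential J (\<gamma> t)) -` {d'<..} else UNIV)"
      unfolding \<Phi>_def by auto
    moreover have "convex (blinfun_apply (differential J (\<gamma> t)) -` {d'<..})"
      by (intro convex_linear_vimage bounded_linear.linear blinfun.bounded_linear_right) auto
    ultimately show ?thesis by (auto intro!: convex_Int)
  qed
  moreover have "\<exists>U w. open U \<and> t \<in> U \<and> (\<forall>s\<in>I \<inter> U. w \<in> \<Phi> s)" if t: "t \<in> I" for t
  proof (cases "m \<le> J (\<gamma> t)")
    case False
    have "openin (top_of_set I) {s \<in> I. J (\<gamma> s) < m}"
      using continuous_openin_preimage_gen[OF contJ, of "{..<m}"]
      by (auto simp: vimage_def Int_def conj_commute)
    then obtain U where U: "open U" "t \<in> U" "\<forall>s\<in>I \<inter> U. J (\<gamma> s) < m"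
      using relopen[of t "\<lambda>s. J (\<gamma> s) < m"] t False by auto
    have "0 \<in> \<Phi> s" if "s \<in> I \<inter> U" for s
    proof -
      have "\<not> m \<le> J (\<gamma> s)" using U(3) that by (simp add: not_le)
      then show ?thesis by (simp add: \<Phi>_def)
    qed
    with U show ?thesis by blast
  next
    case True
    have "d' < norm (differential J (\<gamma> t)) * (1 + norm (\<gamma> t))"
      using steep[of t] t True d unfolding I_def by auto
    then obtain w where w: "norm w < 1 + norm (\<gamma> t)" "d' < differential J (\<gamma> t) w"
      using steep_direction[of d' "differential J (\<gamma> t)" "1 + norm (\<gamma> t)"] d
      by (metis add_pos_nonneg norm_ge_zero zero_less_one)
    have "continuous_on I (\<lambda>s. 1 + norm (\<gamma> s))"
      using \<gamma> unfolding I_def by (intro continuous_intros)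
    moreover have "continuous_on I (\<lambda>s. differential J (\<gamma> s) w)"
      using contD by (intro continuous_intros)
    ultimately have "openin (top_of_set I) (I \<inter> (\<lambda>s. 1 + norm (\<gamma> s)) -` {norm w<..} \<inter>
        (I \<inter> (\<lambda>s. differential J (\<gamma> s) w) -` {d'<..}))"
      by (intro openin_Int continuous_openin_preimage_gen) auto
    moreover have "\<dots> = {s \<in> I. norm w < 1 + norm (\<gamma> s) \<and> d' < differential J (\<gamma> s) w}"
      by auto
    ultimately obtain U where U: "open U" "t \<in> U"
      "\<forall>s\<in>I \<inter> U. norm w < 1 + norm (\<gamma> s) \<and> d' < differential J (\<gamma> s) w"
      using relopen[of t "\<lambda>s. norm w < 1 + norm (\<gamma> s) \<and> d' < differential J (\<gamma> s) w"] t w by auto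
    \<comment> \<open>The endpoints must be removed from \<open>U\<close>, because only the zero vector is admissible there.\<close>
    show ?thesis
    proof (intro exI conjI)
      show "open (U - {0,1})" using U by (intro open_Diff) auto
      show "t \<in> U - {0,1}" using U True ends by auto
      show "\<forall>s\<in>I \<inter> (U - {0,1}). w \<in> \<Phi> s"
      proof
        fix s assume s: "s \<in> I \<inter> (U - {0,1})"
        then have "norm w < 1 + norm (\<gamma> s) \<and> d' < differential J (\<gamma> s) w" using U(3) by blast
        then show "w \<in> \<Phi> s" using s by (simp add: \<Phi>_def)
      qed
    qed
  qed
  moreover have "compact I" by (simp add: I_def)
  ultimately obtain w where w: "continuous_on I w" "\<And>t. t \<in> I \<Longrightarrow> w t \<in> \<Phi> t"
    using continuous_selection_compact[of I \<Phi>] by metis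
  show ?thesis
  proof (rule that)
    show "w 0 = 0" "w 1 = 0" using w(2)[of 0] w(2)[of 1] by (auto simp: \<Phi>_def I_def)
  qed (use w in \<open>auto simp: \<Phi>_def I_def\<close>)
qed

text \<open>The path moves against the descent field for a short time \<open>h\<close>. Near the maximum, in the band
  \<open>J \<ge> m - \<eta>\<close>, the derivative along the motion stays above \<open>d / 4\<close> by uniform continuity,
  and the mean value theorem applies. Below the band \<open>J\<close> rises by less than \<open>\<eta> / 2\<close>, so the
  points cannot reach the new maximum.\<close>

lemma path_lowering:
  fixes \<gamma> :: "real \<Rightarrow> 'x::real_normed_vector"
  assumes C1: "C1_functional J"
    and \<gamma>: "continuous_on {0..1} \<gamma>"
    and below: "\<And>t. t \<in> {0..1} \<Longrightarrow> J (\<gamma> t) \<le> m"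
    and \<eta>: "0 < \<eta>"
    and ends: "J (\<gamma> 0) < m - \<eta>" "J (\<gamma> 1) < m - \<eta>"
    and d: "0 < d"
    and steep: "\<And>t. t \<in> {0..1} \<Longrightarrow> m - \<eta> \<le> J (\<gamma> t) \<Longrightarrow>
        d \<le> norm (differential J (\<gamma> t)) * (1 + norm (\<gamma> t))"
  obtains h \<gamma>' where "0 < h" "continuous_on {0..1} \<gamma>'" "\<gamma>' 0 = \<gamma> 0" "\<gamma>' 1 = \<gamma> 1"
    and "\<And>t. t \<in> {0..1} \<Longrightarrow> norm (\<gamma>' t - \<gamma> t) \<le> h * (1 + norm (\<gamma> t))"
    and "\<And>t. t \<in> {0..1} \<Longrightarrow> J (\<gamma>' t) \<le> m - d / 4 * h"
proof -
  have "0 \<le> d / 2" "d / 2 < d" using d by auto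
  then obtain w where w: "continuous_on {0..1} w" "w 0 = 0" "w 1 = 0"
    "\<And>t. t \<in> {0..1} \<Longrightarrow> norm (w t) \<le> 1 + norm (\<gamma> t)"
    "\<And>t. t \<in> {0..1} \<Longrightarrow> m - \<eta> \<le> J (\<gamma> t) \<Longrightarrow> d / 2 < differential J (\<gamma> t) (w t)"
    by (rule descent_field_along_path[OF C1 \<gamma> ends _ _ steep]) (assumption | rule that)+
  define Q where "Q = {0..1::real} \<times> {0..1::real}"
  define g where "g = (\<lambda>p. \<gamma> (fst p) - snd p *\<^sub>R w (fst p))"
  have cont_fst: "continuous_on Q (\<lambda>p. f (fst p))"
    if "continuous_on {0..1} f" for f :: "real \<Rightarrow> 'x"
    unfolding Q_def by (rule continuous_on_compose2[OF that]) (auto intro!: continuous_intros)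
  have contg: "continuous_on Q g"
    unfolding g_def by (intro continuous_intros cont_fst \<gamma> w)
  have "compact Q" unfolding Q_def by (intro compact_Times) auto
  have "uniformly_continuous_on Q (\<lambda>p. J (g p))"
    by (intro compact_uniformly_continuous \<open>compact Q\<close>
        continuous_on_compose2[OF C1_functional_continuous[OF C1, of UNIV] contg]) auto
  then obtain h1 where h1: "0 < h1"
    "\<And>p q. p \<in> Q \<Longrightarrow> q \<in> Q \<Longrightarrow> dist q p < h1 \<Longrightarrow> dist (J (g q)) (J (g p)) < \<eta> / 2"
    unfolding uniformly_continuous_on_def using half_gt_zero[OF \<eta>] by metis
  have "continuous_on Q (\<lambda>p. differential J (g p))"
    using C1 continuous_on_compose2[OF _ contg] unfolding C1_functional_def by blast
  then have "uniformly_continuous_on Q (\<lambda>p. differential J (g p) (w (fst p)))"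
    by (intro compact_uniformly_continuous \<open>compact Q\<close> continuous_intros cont_fst w)
  then obtain h2 where h2: "0 < h2"
    "\<And>p q. p \<in> Q \<Longrightarrow> q \<in> Q \<Longrightarrow> dist q p < h2 \<Longrightarrow>
      dist (differential J (g q) (w (fst q))) (differential J (g p) (w (fst p))) < d / 4"
    unfolding uniformly_continuous_on_def using d by (metis divide_pos_pos zero_less_numeral)
  \<comment> \<open>The last bound makes \<open>d / 4 * h \<le> \<eta> / 2\<close>, so that points below the band stay low enough.\<close>
  define h where "h = Min {1, h1 / 2, h2 / 2, \<eta> / d}"
  have h: "0 < h" "h \<le> 1" "h < h1" "h < h2" "h * d \<le> \<eta>"
  proof -
    have "h \<le> h1 / 2" "h \<le> h2 / 2" "h \<le> \<eta> / d" unfolding h_def by (rule Min_le; simp)+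
    then show "h < h1" "h < h2" "h * d \<le> \<eta>"
      using h1(1) h2(1) d by (auto simp: field_simps)
    show "0 < h" "h \<le> 1" using h1(1) h2(1) \<eta> d by (auto simp: h_def)
  qed
  have low: "J (\<gamma> t - h *\<^sub>R w t) \<le> m - d / 4 * h" if t: "t \<in> {0..1}" for t
  proof (cases "m - \<eta> \<le> J (\<gamma> t)")
    case False
    have "dist (J (g (t, h))) (J (g (t, 0))) < \<eta> / 2"
      using t h by (intro h1) (auto simp: Q_def dist_Pair_Pair)
    then have "J (\<gamma> t - h *\<^sub>R w t) < J (\<gamma> t) + \<eta> / 2"
      by (simp add: g_def dist_real_def abs_if split: if_splits)
    moreover have "d / 4 * h \<le> \<eta> / 2" using h(5) \<eta> by (simp add: mult.commute)
    ultimately show ?thesis using False by linarith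
  next
    case True
    have "J differentiable (at u)" for u using C1 unfolding C1_functional_def by auto
    then have derJ: "(J has_derivative differential J u) (at u)" for u
      by (rule has_derivative_differential)
    have "((\<lambda>x. \<gamma> t - x *\<^sub>R w t) has_vector_derivative - w t) (at x)" for x
      by (auto intro!: derivative_eq_intros)
    then have der: "((\<lambda>x. J (\<gamma> t - x *\<^sub>R w t)) has_real_derivative
        - differential J (\<gamma> t - x *\<^sub>R w t) (w t)) (at x)" for x
      using vector_derivative_diff_chain_within[of "\<lambda>x. \<gamma> t - x *\<^sub>R w t" "- w t" x UNIV J]
        has_derivative_at_withinI[OF derJ]
      by (force simp: o_def has_real_derivative_iff_has_vector_derivative blinfun.bilinear_simps)
    obtain z where z: "0 < z" "z < h" and
      mvt: "J (\<gamma> t - h *\<^sub>R w t) - J (\<gamma> t - 0 *\<^sub>R w t) =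
        (h - 0) * (- differential J (\<gamma> t - z *\<^sub>R w t) (w t))"
      using MVT2[OF h(1) der] by blast
    have "dist (differential J (g (t, z)) (w t)) (differential J (g (t, 0)) (w t)) < d / 4"
      using h2(2)[of "(t, 0)" "(t, z)"] t h z by (auto simp: Q_def dist_Pair_Pair)
    with w(5)[OF t True] have "d / 4 < differential J (\<gamma> t - z *\<^sub>R w t) (w t)"
      by (simp add: g_def dist_real_def abs_if split: if_splits)
    then have "h * (d / 4) \<le> h * differential J (\<gamma> t - z *\<^sub>R w t) (w t)"
      using h by (intro mult_left_mono) auto
    then show ?thesis using mvt below[OF t] by (simp add: algebra_simps)
  qed
  show ?thesis
  proof (rule that[of h "\<lambda>t. \<gamma> t - h *\<^sub>R w t"])
    show "continuous_on {0..1} (\<lambda>t. \<gamma> t - h *\<^sub>R w t)" by (intro continuous_intros \<gamma> w)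
    show "norm ((\<gamma> t - h *\<^sub>R w t) - \<gamma> t) \<le> h * (1 + norm (\<gamma> t))" if "t \<in> {0..1}" for t
      using w(4)[OF that] h by simp
  qed (use h w low in auto)
qed

section \<open>The minimax level\<close>

definition path_sup :: "('x::real_normed_vector \<Rightarrow> real) \<Rightarrow> (real \<Rightarrow> 'x) \<Rightarrow> real" where
  "path_sup J \<gamma> = (SUP \<sigma>\<in>{0..1}. J (\<gamma> \<sigma>))"

lemma path_sup_upper:
  assumes "continuous_on UNIV J" "continuous_on {0..1} \<gamma>" "t \<in> {0..1}"
  shows "J (\<gamma> t) \<le> path_sup J \<gamma>"
proof -
  have "continuous_on {0..1} (\<lambda>t. J (\<gamma> t))"
    by (rule continuous_on_compose2[OF assms(1,2)]) auto
  then have "compact ((\<lambda>t. J (\<gamma> t)) ` {0..1})"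
    by (rule compact_continuous_image) auto
  then show ?thesis
    unfolding path_sup_def
    by (intro cSUP_upper assms bounded_imp_bdd_above compact_imp_bounded)
qed

lemma path_sup_least:
  assumes "\<And>t. t \<in> {0..1} \<Longrightarrow> J (\<gamma> t) \<le> b"
  shows "path_sup J \<gamma> \<le> b"
  unfolding path_sup_def using assms by (intro cSUP_least) auto

lemma path_sup_ge_start:
  assumes "continuous_on UNIV J" "\<gamma> \<in> mp_paths e"
  shows "J 0 \<le> path_sup J \<gamma>"
  using path_sup_upper[OF assms(1), of \<gamma> 0] assms(2) by (simp add: mp_paths_def)

lemma mp_level_eq: "mp_level J e = (INF \<gamma>\<in>mp_paths e. path_sup J \<gamma>)"
  by (simp add: mp_level_def path_sup_def)

lemma mp_level_le_path_sup:
  assumes "continuous_on UNIV J" "\<gamma> \<in> mp_paths e"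
  shows "mp_level J e \<le> path_sup J \<gamma>"
  unfolding mp_level_eq
  by (intro cINF_lower assms(2) bdd_belowI2[of _ "J 0"] path_sup_ge_start[OF assms(1)])

lemma mp_paths_nonempty: "mp_paths e \<noteq> {}"
proof -
  have "(\<lambda>t. t *\<^sub>R e) \<in> mp_paths e"
    unfolding mp_paths_def by (auto intro!: continuous_intros)
  then show ?thesis by blast
qed

text \<open>By the intermediate value theorem every path meets the level set \<open>l = r\<close>.\<close>

lemma mp_level_ge_barrier:
  fixes J l :: "'x::real_normed_vector \<Rightarrow> real"
  assumes "continuous_on UNIV J" "continuous_on UNIV l"
    and "l 0 \<le> r" "r \<le> l e" "\<And>u. l u = r \<Longrightarrow> \<rho> \<le> J u"
  shows "\<rho> \<le> mp_level J e"
  unfolding mp_level_eq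
proof (rule cINF_greatest[OF mp_paths_nonempty])
  fix \<gamma> assume "\<gamma> \<in> mp_paths e"
  then have \<gamma>: "continuous_on {0..1} \<gamma>" "\<gamma> 0 = 0" "\<gamma> 1 = e" by (auto simp: mp_paths_def)
  have "continuous_on {0..1} (\<lambda>t. l (\<gamma> t))"
    by (rule continuous_on_compose2[OF assms(2) \<gamma>(1)]) auto
  then obtain t where "0 \<le> t" "t \<le> 1" "l (\<gamma> t) = r"
    using IVT'[of "\<lambda>t. l (\<gamma> t)" 0 r 1] \<gamma> assms by auto
  then show "\<rho> \<le> path_sup J \<gamma>"
    using assms(5) path_sup_upper[OF assms(1) \<gamma>(1), of t] by fastforce
qed

section \<open>Cerami sequences at the minimax level\<close>

lemma steep_band_if_no_CPS_sequence:
  assumes "\<nexists>u. CPS_sequence J c u"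
  obtains \<epsilon> where "0 < \<epsilon>"
    "\<And>u. \<bar>J u - c\<bar> \<le> \<epsilon> \<Longrightarrow> \<epsilon> \<le> norm (differential J u) * (1 + norm u)"
proof (rule ccontr)
  assume "\<not> thesis"
  with that have "\<exists>u. \<bar>J u - c\<bar> \<le> inverse (real (Suc n)) \<and>
      norm (differential J u) * (1 + norm u) < inverse (real (Suc n))" for n
    by (metis inverse_positive_iff_positive not_le of_nat_0_less_iff zero_less_Suc)
  then obtain u where u: "\<And>n. \<bar>J (u n) - c\<bar> \<le> inverse (real (Suc n))"
      "\<And>n. norm (differential J (u n)) * (1 + norm (u n)) < inverse (real (Suc n))"
    by metis
  have "(\<lambda>n. J (u n) - c) \<longlonglongrightarrow> 0"
    by (rule Lim_null_comparison[OF _ LIMSEQ_inverse_real_of_nat]) (use u(1) in auto)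
  moreover have "(\<lambda>n. norm (differential J (u n)) * (1 + norm (u n))) \<longlonglongrightarrow> 0"
    by (rule Lim_null_comparison[OF _ LIMSEQ_inverse_real_of_nat])
      (use less_imp_le[OF u(2)] in \<open>auto simp: abs_mult\<close>)
  ultimately have "CPS_sequence J c u"
    unfolding CPS_sequence_def by (simp add: LIM_zero_iff)
  with assms show False by blast
qed

text \<open>A move of length \<open>s\<close> is measured relative to \<open>1 + norm\<close>, the weight of the Cerami condition.
  Requiring a drop of the maximum by \<open>\<kappa> * s\<close> is the ordering of Ekeland's principle for this
  weighted distance between paths.\<close>

definition lowering_step ::
    "('x::real_normed_vector \<Rightarrow> real) \<Rightarrow> 'x \<Rightarrow> real \<Rightarrow> (real \<Rightarrow> 'x) \<Rightarrow> (real \<Rightarrow> 'x) \<Rightarrow> real \<Rightarrow> bool" where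
  "lowering_step J e \<kappa> \<gamma> \<gamma>' s \<longleftrightarrow> \<gamma>' \<in> mp_paths e \<and> 0 \<le> s \<and>
     (\<forall>t\<in>{0..1}. norm (\<gamma>' t - \<gamma> t) \<le> s * (1 + norm (\<gamma> t))) \<and>
     path_sup J \<gamma>' \<le> path_sup J \<gamma> - \<kappa> * s"

text \<open>The length of a step is bounded, since the maximum along a path never falls below \<open>J 0\<close>.
  A step of more than half the supremal length therefore exists, unless that supremum is \<open>0\<close>
  and staying put is already optimal.\<close>

lemma almost_longest_lowering_step:
  assumes J: "continuous_on UNIV J" and "0 < \<kappa>" and \<gamma>: "\<gamma> \<in> mp_paths e"
  obtains \<gamma>' s where "lowering_step J e \<kappa> \<gamma> \<gamma>' s"
    "\<And>\<gamma>'' s'. lowering_step J e \<kappa> \<gamma> \<gamma>'' s' \<Longrightarrow> s' \<le> 2 * s"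
proof -
  define A where "A = {s. \<exists>\<gamma>'. lowering_step J e \<kappa> \<gamma> \<gamma>' s}"
  have "0 \<in> A" using \<gamma> by (auto simp: A_def lowering_step_def intro: exI[of _ \<gamma>])
  have bdd: "bdd_above A"
  proof (rule bdd_aboveI)
    fix s assume "s \<in> A"
    then obtain \<gamma>' where "\<gamma>' \<in> mp_paths e" "path_sup J \<gamma>' \<le> path_sup J \<gamma> - \<kappa> * s"
      by (auto simp: A_def lowering_step_def)
    then have "\<kappa> * s \<le> path_sup J \<gamma> - J 0"
      using path_sup_ge_start[OF J] by fastforce
    then show "s \<le> (path_sup J \<gamma> - J 0) / \<kappa>"
      using \<open>0 < \<kappa>\<close> by (simp add: field_simps)
  qed
  have upper: "s \<le> Sup A" if "s \<in> A" for s using that bdd by (rule cSup_upper)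
  have "\<exists>s\<in>A. Sup A \<le> 2 * s"
  proof (cases "Sup A = 0")
    case True
    with \<open>0 \<in> A\<close> show ?thesis by auto
  next
    case False
    then have "Sup A / 2 < Sup A" using upper[OF \<open>0 \<in> A\<close>] by simp
    then obtain s where "s \<in> A" "Sup A / 2 < s"
      using less_cSup_iff[OF _ bdd] \<open>0 \<in> A\<close> by blast
    then show ?thesis by (intro bexI[of _ s]) auto
  qed
  then obtain s where s: "s \<in> A" "Sup A \<le> 2 * s" by blast
  then obtain \<gamma>' where \<gamma>': "lowering_step J e \<kappa> \<gamma> \<gamma>' s" by (auto simp: A_def)
  have "s' \<le> 2 * s" if "lowering_step J e \<kappa> \<gamma> \<gamma>'' s'" for \<gamma>'' s'
    using upper[of s'] that s by (force simp: A_def)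
  with \<gamma>' show ?thesis by (rule that)
qed

text \<open>The analogue of Ekeland's variational principle: almost longest steps are iterated and
  the limit is stuck. A step of length \<open>h\<close> from the limit path is only nearly a step of length \<open>h\<close>
  from the late iterates; allowing them the length \<open>2 * h\<close> absorbs the error, and the iteration
  therefore uses half of the slope \<open>\<kappa>\<close>.\<close>

lemma path_without_lowering_step:
  fixes J :: "'x::banach \<Rightarrow> real"
  assumes J: "continuous_on UNIV J" and \<kappa>: "0 < \<kappa>" and \<gamma>\<^sub>0: "\<gamma>\<^sub>0 \<in> mp_paths e"
  obtains \<gamma> where "\<gamma> \<in> mp_paths e" "path_sup J \<gamma> \<le> path_sup J \<gamma>\<^sub>0"
    "\<And>\<gamma>' h. 0 < h \<Longrightarrow> \<not> lowering_step J e \<kappa> \<gamma> \<gamma>' h"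
proof -
  define \<kappa>' where "\<kappa>' = \<kappa> / 2"
  have \<kappa>': "0 < \<kappa>'" "\<kappa> = 2 * \<kappa>'" using \<kappa> by (simp_all add: \<kappa>'_def)
  \<comment> \<open>The iteration runs on pairs of a path and the length of the step that led to it.\<close>
  define good where "good p q \<longleftrightarrow> lowering_step J e \<kappa>' (fst p) (fst q) (snd q) \<and>
      (\<forall>\<gamma>'' s'. lowering_step J e \<kappa>' (fst p) \<gamma>'' s' \<longrightarrow> s' \<le> 2 * snd q)"
    for p q :: "(real \<Rightarrow> 'x) \<times> real"
  have "\<exists>f. \<forall>n. fst (f n) \<in> mp_paths e \<and> (n = 0 \<longrightarrow> fst (f n) = \<gamma>\<^sub>0) \<and> good (f n) (f (Suc n))"
  proof -
    have "\<exists>q. fst q \<in> mp_paths e \<and> (Suc n = 0 \<longrightarrow> fst q = \<gamma>\<^sub>0) \<and> good p q"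
      if p: "fst p \<in> mp_paths e \<and> (n = 0 \<longrightarrow> fst p = \<gamma>\<^sub>0)" for p n
    proof -
      obtain \<gamma>' s where "lowering_step J e \<kappa>' (fst p) \<gamma>' s"
        "\<And>\<gamma>'' s'. lowering_step J e \<kappa>' (fst p) \<gamma>'' s' \<Longrightarrow> s' \<le> 2 * s"
        using almost_longest_lowering_step[OF J \<kappa>'(1) conjunct1[OF p]] by blast
      then show ?thesis
        by (intro exI[of _ "(\<gamma>', s)"]) (auto simp: good_def lowering_step_def)
    qed
    then show ?thesis
      using dependent_nat_choice[of "\<lambda>n p. fst p \<in> mp_paths e \<and> (n = 0 \<longrightarrow> fst p = \<gamma>\<^sub>0)" "\<lambda>_. good"]
        \<gamma>\<^sub>0 by (metis (no_types, lifting) fst_conv)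
  qed
  then obtain f where f: "\<And>n. fst (f n) \<in> mp_paths e" "fst (f 0) = \<gamma>\<^sub>0"
    "\<And>n. good (f n) (f (Suc n))" by metis
  define g where "g n = fst (f n)" for n
  define s where "s n = snd (f (Suc n))" for n
  have g0: "g 0 = \<gamma>\<^sub>0" by (simp add: g_def f)
  have g_path: "g n \<in> mp_paths e" for n by (simp add: g_def f)
  then have g: "continuous_on {0..1} (g n)" "g n 0 = 0" "g n 1 = e" for n
    by (auto simp: mp_paths_def)
  have step: "0 \<le> s n" "path_sup J (g (Suc n)) \<le> path_sup J (g n) - \<kappa>' * s n"
    and move: "t \<in> {0..1} \<Longrightarrow> norm (g (Suc n) t - g n t) \<le> s n * (1 + norm (g n t))"
    and longest: "lowering_step J e \<kappa>' (g n) \<gamma>'' s' \<Longrightarrow> s' \<le> 2 * s n" for n t \<gamma>'' s'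
    using f(3)[of n] by (auto simp: good_def lowering_step_def g_def s_def)
  have "\<kappa>' * (\<Sum>k<n. s k) \<le> path_sup J \<gamma>\<^sub>0 - path_sup J (g n)" for n
  proof (induction n)
    case (Suc n)
    then show ?case using step(2)[of n] by (simp add: algebra_simps)
  qed (simp add: g0)
  then have "\<kappa>' * (\<Sum>k<n. s k) \<le> path_sup J \<gamma>\<^sub>0 - J 0" for n
    using path_sup_ge_start[OF J g_path[of n]] by (smt (verit))
  then have sum_s: "(\<Sum>k<n. s k) \<le> (path_sup J \<gamma>\<^sub>0 - J 0) / \<kappa>'" for n
    using \<kappa>'(1) by (simp add: field_simps)
  then have "summable s"
    by (intro summableI_nonneg_bounded step(1))
  have decr: "decseq (\<lambda>n. path_sup J (g n))"
    using step \<kappa>'(1) by (intro decseq_SucI) (smt (verit) mult_nonneg_nonneg)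

  \<comment> \<open>Summable lengths bound the weights \<open>1 + norm\<close> along all iterates, which turns the weighted
    steps into summable steps in the supremum norm.\<close>
  have growth: "1 + norm (g n t) \<le> exp (\<Sum>k<n. s k) * (1 + norm (\<gamma>\<^sub>0 t))" if "t \<in> {0..1}" for n t
  proof (induction n)
    case (Suc n)
    have "norm (g (Suc n) t) \<le> norm (g n t) + norm (g (Suc n) t - g n t)"
      by (rule norm_triangle_sub)
    then have "1 + norm (g (Suc n) t) \<le> (1 + s n) * (1 + norm (g n t))"
      using move[OF that, of n] by (simp add: algebra_simps)
    also have "\<dots> \<le> exp (s n) * (1 + norm (g n t))"
      by (intro mult_right_mono exp_ge_add_one_self) auto
    also have "\<dots> \<le> exp (s n) * (exp (\<Sum>k<n. s k) * (1 + norm (\<gamma>\<^sub>0 t)))"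
      by (intro mult_left_mono Suc) auto
    finally show ?case by (simp add: exp_add mult_ac)
  qed (simp add: g0)
  obtain B where B: "\<And>t. t \<in> {0..1} \<Longrightarrow> norm (\<gamma>\<^sub>0 t) \<le> B"
  proof -
    have "compact (\<gamma>\<^sub>0 ` {0..1})" using g(1)[of 0] g0 by (auto intro: compact_continuous_image)
    then show ?thesis using that by (force dest!: compact_imp_bounded simp: bounded_iff)
  qed
  define C where "C = exp ((path_sup J \<gamma>\<^sub>0 - J 0) / \<kappa>') * (1 + B)"
  have bound: "1 + norm (g n t) \<le> C" if "t \<in> {0..1}" for n t
  proof -
    have "exp (\<Sum>k<n. s k) * (1 + norm (\<gamma>\<^sub>0 t)) \<le> C"
      unfolding C_def using B[OF that] sum_s by (intro mult_mono) auto
    with growth[OF that] show ?thesis by (rule order_trans)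
  qed
  have "norm (g (Suc n) t - g n t) \<le> s n * C" if "t \<in> {0..1}" for n t
    using move[OF that] mult_left_mono[OF bound[OF that] step(1)] by (rule order_trans)
  then have "uniform_limit {0..1} (\<lambda>n t. \<Sum>k<n. g (Suc k) t - g k t)
      (\<lambda>t. \<Sum>k. g (Suc k) t - g k t) sequentially"
    by (rule Weierstrass_m_test) (assumption | intro summable_mult2 \<open>summable s\<close>)+
  moreover have "(\<Sum>k<n. g (Suc k) t - g k t) = g n t - \<gamma>\<^sub>0 t" for n t
    by (simp add: sum_lessThan_telescope[of "\<lambda>k. g k t"] g0)
  ultimately have lim_diff: "uniform_limit {0..1} (\<lambda>n t. g n t - \<gamma>\<^sub>0 t)
      (\<lambda>t. \<Sum>k. g (Suc k) t - g k t) sequentially"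
    by simp
  define \<gamma> where "\<gamma> t = (\<Sum>k. g (Suc k) t - g k t) + \<gamma>\<^sub>0 t" for t
  have lim: "uniform_limit {0..1} g \<gamma> sequentially"
    using uniform_limit_add[OF lim_diff uniform_limit_const[where S = "{0..1}" and c = \<gamma>\<^sub>0 and f = sequentially]]
    by (simp add: \<gamma>_def[abs_def])
  have pointwise: "(\<lambda>n. g n t) \<longlonglongrightarrow> \<gamma> t" if "t \<in> {0..1}" for t
    using tendsto_uniform_limitI[OF lim that] .
  have cont: "continuous_on {0..1} \<gamma>"
    by (rule uniform_limit_theorem[OF _ lim]) (auto simp: g)
  have "\<gamma> 0 = 0" "\<gamma> 1 = e"
    using LIMSEQ_unique[OF pointwise[of 0]] LIMSEQ_unique[OF pointwise[of 1]]
    by (auto simp: g)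
  with cont have \<gamma>_path: "\<gamma> \<in> mp_paths e" by (simp add: mp_paths_def)
  have sup_le: "path_sup J \<gamma> \<le> path_sup J (g n)" for n
  proof (rule path_sup_least)
    fix t :: real assume t: "t \<in> {0..1}"
    have "(\<lambda>k. J (g k t)) \<longlonglongrightarrow> J (\<gamma> t)"
      using J pointwise[OF t] by (auto intro: continuous_on_tendsto_compose)
    moreover have "J (g k t) \<le> path_sup J (g n)" if "k \<ge> n" for k
      using path_sup_upper[OF J g(1) t] decseqD[OF decr that] by (rule order_trans)
    ultimately show "J (\<gamma> t) \<le> path_sup J (g n)"
      by (intro LIMSEQ_le_const2) blast+
  qed
  show ?thesis
  proof (rule that[OF \<gamma>_path])
    show "path_sup J \<gamma> \<le> path_sup J \<gamma>\<^sub>0" using sup_le[of 0] by (simp add: g0)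
  next
    fix \<gamma>' :: "real \<Rightarrow> 'x" and h :: real
    assume h: "0 < h"
    show "\<not> lowering_step J e \<kappa> \<gamma> \<gamma>' h"
    proof
      assume "lowering_step J e \<kappa> \<gamma> \<gamma>' h"
      then have \<gamma>': "\<gamma>' \<in> mp_paths e"
        and near: "\<And>t. t \<in> {0..1} \<Longrightarrow> norm (\<gamma>' t - \<gamma> t) \<le> h * (1 + norm (\<gamma> t))"
        and drop: "path_sup J \<gamma>' \<le> path_sup J \<gamma> - \<kappa>' * (2 * h)"
        by (auto simp: lowering_step_def \<kappa>'(2))
      \<comment> \<open>Chosen so that an error \<open>\<theta>\<close> in the weight and in the distance costs \<open>h * \<theta> + \<theta> = h\<close>.\<close>
      define \<theta> where "\<theta> = h / (1 + h)"
      have \<theta>: "0 < \<theta>" "(1 + h) * \<theta> = h" using h by (auto simp: \<theta>_def)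
      have "\<forall>\<^sub>F n in sequentially. \<forall>t\<in>{0..1}. dist (g n t) (\<gamma> t) < \<theta>"
        using uniform_limitD[OF lim \<theta>(1)] .
      moreover have "\<forall>\<^sub>F n in sequentially. s n < h"
        using order_tendstoD(2)[OF summable_LIMSEQ_zero[OF \<open>summable s\<close>] h] .
      ultimately have "\<forall>\<^sub>F n in sequentially. (\<forall>t\<in>{0..1}. dist (g n t) (\<gamma> t) < \<theta>) \<and> s n < h"
        by (rule eventually_conj)
      then obtain n where n: "\<And>t. t \<in> {0..1} \<Longrightarrow> dist (g n t) (\<gamma> t) < \<theta>" "s n < h"
        unfolding eventually_sequentially by blast
      have "norm (\<gamma>' t - g n t) \<le> 2 * h * (1 + norm (g n t))" if t: "t \<in> {0..1}" for t
      proof -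
        have close: "norm (\<gamma> t - g n t) \<le> \<theta>"
          using n(1)[OF t] by (simp add: dist_norm norm_minus_commute)
        have "norm (\<gamma>' t - g n t) \<le> norm (\<gamma>' t - \<gamma> t) + norm (\<gamma> t - g n t)"
          by (metis norm_diff_triangle_ineq diff_add_cancel norm_triangle_ineq add_diff_eq)
        also have "\<dots> \<le> h * (1 + norm (\<gamma> t)) + \<theta>"
          using near[OF t] close by (rule add_mono)
        also have "\<dots> \<le> h * (1 + norm (g n t) + \<theta>) + \<theta>"
        proof -
          have "norm (\<gamma> t) \<le> norm (g n t) + \<theta>"
            using norm_triangle_sub[of "\<gamma> t" "g n t"] close by linarith
          then show ?thesis using h by simp
        qed
        also have "\<dots> = h * (1 + norm (g n t)) + h"
          using \<theta>(2) by (simp add: algebra_simps)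
        also have "\<dots> \<le> 2 * h * (1 + norm (g n t))"
          using h by (simp add: algebra_simps)
        finally show ?thesis .
      qed
      moreover have "path_sup J \<gamma>' \<le> path_sup J (g n) - \<kappa>' * (2 * h)"
        using drop sup_le[of n] by linarith
      ultimately have "lowering_step J e \<kappa>' (g n) \<gamma>' (2 * h)"
        using \<gamma>' h by (simp add: lowering_step_def)
      then have "2 * h \<le> 2 * s n" by (rule longest)
      with n(2) show False by simp
    qed
  qed
qed

text \<open>If the minimax level \<open>c\<close> had no Cerami sequence, the path obtained from \<open>path_without_lowering_step\<close>, started
  with maximum at most \<open>c + \<epsilon>\<close>, could be lowered by \<open>path_lowering\<close>.\<close>

theorem mountain_pass_CPS_sequence:
  fixes J :: "'x::banach \<Rightarrow> real"
  assumes C1: "C1_functional J" and ends: "J 0 < mp_level J e" "J e < mp_level J e"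
  obtains u where "CPS_sequence J (mp_level J e) u"
proof (rule ccontr)
  assume "\<not> thesis"
  with that have "\<nexists>u. CPS_sequence J (mp_level J e) u" by blast
  then obtain \<epsilon> where \<epsilon>: "0 < \<epsilon>" "\<And>u. \<bar>J u - mp_level J e\<bar> \<le> \<epsilon> \<Longrightarrow>
      \<epsilon> \<le> norm (differential J u) * (1 + norm u)"
    using steep_band_if_no_CPS_sequence by metis
  have J: "continuous_on UNIV J" by (rule C1_functional_continuous[OF C1])
  have "(INF \<gamma>\<in>mp_paths e. path_sup J \<gamma>) < mp_level J e + \<epsilon>"
    unfolding mp_level_eq using \<epsilon> by simp
  then obtain \<gamma>\<^sub>0 where \<gamma>\<^sub>0: "\<gamma>\<^sub>0 \<in> mp_paths e" "path_sup J \<gamma>\<^sub>0 < mp_level J e + \<epsilon>"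
    using cInf_lessD[of "path_sup J ` mp_paths e"] mp_paths_nonempty by blast
  have "0 < \<epsilon> / 4" using \<epsilon> by simp
  obtain \<gamma> where \<gamma>: "\<gamma> \<in> mp_paths e" "path_sup J \<gamma> \<le> path_sup J \<gamma>\<^sub>0"
    and stuck: "\<And>\<gamma>' h. 0 < h \<Longrightarrow> \<not> lowering_step J e (\<epsilon> / 4) \<gamma> \<gamma>' h"
    using path_without_lowering_step[OF J \<open>0 < \<epsilon> / 4\<close> \<gamma>\<^sub>0(1)] by metis
  have \<gamma>_cont: "continuous_on {0..1} \<gamma>" and \<gamma>_ends: "\<gamma> 0 = 0" "\<gamma> 1 = e"
    using \<gamma>(1) by (auto simp: mp_paths_def)
  have level: "mp_level J e \<le> path_sup J \<gamma>" "path_sup J \<gamma> \<le> mp_level J e + \<epsilon>"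
    using mp_level_le_path_sup[OF J \<gamma>(1)] \<gamma> \<gamma>\<^sub>0 by auto
  \<comment> \<open>The band of width \<open>\<eta>\<close> below the maximum stays above level \<open>c - \<epsilon>\<close>, where \<open>J\<close> is steep, and
    excludes both endpoints.\<close>
  define \<eta> where "\<eta> = Min {\<epsilon>, (mp_level J e - J 0) / 2, (mp_level J e - J e) / 2}"
  have \<eta>: "0 < \<eta>" "\<eta> \<le> \<epsilon>" "J 0 < mp_level J e - \<eta>" "J e < mp_level J e - \<eta>"
    using ends \<epsilon> by (auto simp: \<eta>_def min_def field_simps)
  have below: "J (\<gamma> t) \<le> path_sup J \<gamma>" if "t \<in> {0..1}" for t
    using path_sup_upper[OF J \<gamma>_cont that] .
  have gap: "J (\<gamma> 0) < path_sup J \<gamma> - \<eta>" "J (\<gamma> 1) < path_sup J \<gamma> - \<eta>"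
    using \<eta> level by (auto simp: \<gamma>_ends)
  have steep: "\<epsilon> \<le> norm (differential J (\<gamma> t)) * (1 + norm (\<gamma> t))"
    if "t \<in> {0..1}" "path_sup J \<gamma> - \<eta> \<le> J (\<gamma> t)" for t
    using that below[of t] level \<eta> by (intro \<epsilon>(2)) auto
  obtain h \<gamma>' where \<gamma>': "0 < h" "continuous_on {0..1} \<gamma>'" "\<gamma>' 0 = \<gamma> 0" "\<gamma>' 1 = \<gamma> 1"
    "\<And>t. t \<in> {0..1} \<Longrightarrow> norm (\<gamma>' t - \<gamma> t) \<le> h * (1 + norm (\<gamma> t))"
    "\<And>t. t \<in> {0..1} \<Longrightarrow> J (\<gamma>' t) \<le> path_sup J \<gamma> - \<epsilon> / 4 * h"
    by (rule path_lowering[OF C1 \<gamma>_cont below \<eta>(1) gap \<epsilon>(1) steep]) (assumption | rule that)+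
  have "\<gamma>' \<in> mp_paths e" using \<gamma>' \<gamma>_ends by (simp add: mp_paths_def)
  moreover have "path_sup J \<gamma>' \<le> path_sup J \<gamma> - \<epsilon> / 4 * h"
    using \<gamma>'(6) by (rule path_sup_least)
  ultimately have "lowering_step J e (\<epsilon> / 4) \<gamma> \<gamma>' h"
    using \<gamma>'(1,5) by (simp add: lowering_step_def)
  with stuck[OF \<gamma>'(1)] show False by blast
qed

theorem theorem2p3:
  fixes i :: "'x::banach \<Rightarrow> 'w::banach"
    and J :: "'x \<Rightarrow> real"
    and l :: "'x \<Rightarrow> real"
    and r\<^sub>0 \<rho>\<^sub>0 :: real
    and e :: 'x
  assumes "continuous_embedding i"
    and "C1_functional J"
    and "J 0 = 0"
    and "\<And>\<beta>. \<beta> > 0 \<Longrightarrow> wCPS i J \<beta>"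
    and "continuous_on UNIV l"
    and "r\<^sub>0 > 0" and "\<rho>\<^sub>0 > 0"
    and "l 0 = 0" and "\<And>u. l u \<ge> norm (i u)"
    and "\<And>u. l u = r\<^sub>0 \<Longrightarrow> J u \<ge> \<rho>\<^sub>0"
    and "norm (i e) > r\<^sub>0" and "J e < \<rho>\<^sub>0"
  shows "\<exists>u\<^sub>0. differential J u\<^sub>0 = 0 \<and> J u\<^sub>0 = mp_level J e \<and> mp_level J e \<ge> \<rho>\<^sub>0"
proof -
  have "r\<^sub>0 \<le> l e" using assms(9)[of e] assms(11) by simp
  then have level: "\<rho>\<^sub>0 \<le> mp_level J e"
    using mp_level_ge_barrier[OF C1_functional_continuous[OF assms(2)] assms(5), of r\<^sub>0 e \<rho>\<^sub>0]
      assms(6,8,10) by auto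
  then obtain u where "CPS_sequence J (mp_level J e) u"
    using mountain_pass_CPS_sequence[OF assms(2), of e] assms(3,7,12) by auto
  moreover have "wCPS i J (mp_level J e)" using assms(4,7) level by auto
  ultimately obtain v where "J v = mp_level J e" "differential J v = 0"
    unfolding wCPS_def by blast
  with level show ?thesis by blast
qed

end
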